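(* Let $d\in\mathbb{N}$, $d>1$, and let $$-\frac{2d(d+2)}{2d^2+1}<\alpha<0.$$ Then there exists a constant $C_0=C_0(\alpha,d)>0$ such that for all positive smooth functions $\rho$ on the $d$-dimensional torus $\mathbb{T}^d$, $$-\int_{\mathbb{T}^d}\nabla\rho\cdot\nabla\bigg(\rho^{\alpha/2}\frac{\Delta\rho^{\alpha/2+1}}{\alpha/2+1}\bigg)dx\ \ge\ C_0\int_{\mathbb{T}^d}\big(|\nabla\rho^{\alpha/4+1/2}|^4+|\Delta\rho^{\alpha/2+1}|^2\big)dx.$$
   Context: Expressions such as $\nabla\rho^{a}$ and $\Delta\rho^{a}$ denote $\nabla(\rho^a)$ and $\Delta(\rho^a)$. *)

theory Defs
  imports "HOL-Analysis.Analysis"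
begin

text \<open>
  The torus of dimension \<open>d = CARD('n)\<close> is the quotient of \<open>real ^ 'n\<close> by the integer lattice.
  A function on it is a function on \<open>real ^ 'n\<close> that is 1-periodic in every coordinate, and its
  integral is the integral over the unit cube.
\<close>

definition torus_fun :: "(real ^ 'n \<Rightarrow> 'b) \<Rightarrow> bool" where
  "torus_fun f \<longleftrightarrow> (\<forall>x i. f (x + axis i 1) = f x)"

definition torus_integral :: "(real ^ 'n \<Rightarrow> real) \<Rightarrow> real" where
  "torus_integral f = integral (cbox 0 1) f"

definition partial_deriv :: "'n \<Rightarrow> (real ^ 'n \<Rightarrow> real) \<Rightarrow> real ^ 'n \<Rightarrow> real" where
  "partial_deriv i f x = deriv (\<lambda>t. f (x + t *\<^sub>R axis i 1)) 0"

definition grad :: "(real ^ 'n \<Rightarrow> real) \<Rightarrow> real ^ 'n \<Rightarrow> real ^ 'n" where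
  "grad f x = (\<chi> i. partial_deriv i f x)"

definition laplacian :: "(real ^ 'n \<Rightarrow> real) \<Rightarrow> real ^ 'n \<Rightarrow> real" where
  "laplacian f x = (\<Sum>i\<in>UNIV. partial_deriv i (partial_deriv i f) x)"

text \<open>
  Total differentiability is required at each stage so that the value of
  \<^const>\<open>partial_deriv\<close> is never the arbitrary one that \<^const>\<open>deriv\<close> takes at points of
  non-differentiability. It also makes all derivatives of order below \<open>k\<close> continuous.
\<close>

primrec C_k :: "nat \<Rightarrow> (real ^ 'n \<Rightarrow> real) \<Rightarrow> bool" where
  "C_k 0 f \<longleftrightarrow> continuous_on UNIV f"
| "C_k (Suc k) f \<longleftrightarrow> (\<forall>x. f differentiable (at x)) \<and> (\<forall>i. C_k k (partial_deriv i f))"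

definition smooth :: "(real ^ 'n \<Rightarrow> real) \<Rightarrow> bool" where
  "smooth f \<longleftrightarrow> (\<forall>k. C_k k f)"

end

theory Submission
  imports Defs
begin

text \<open>
  Write \<open>b = - \<alpha> / 2\<close>, so that \<open>0 < b < 1\<close>, and abbreviate \<open>N = |\<nabla>\<rho>|\<^sup>2\<close>, \<open>L = \<Delta>\<rho>\<close>. One integration
  by parts turns the left-hand side into the integral of \<open>X\<^sup>2 - b X Y\<close> with
  \<open>X = \<rho> powr (- b) * L\<close> and \<open>Y = \<rho> powr (- b - 1) * N\<close>. By the chain rule the integrand on the right
  is a combination of \<open>Y\<^sup>2\<close> and \<open>(X - b Y)\<^sup>2\<close>, so it suffices to bound the left-hand side from below
  by a positive multiple of the integral of \<open>X\<^sup>2 + Y\<^sup>2\<close>.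

  The form \<open>X\<^sup>2 - b X Y\<close> is indefinite, so no pointwise bound exists. What is free is to add
  multiples of expressions of integral zero. Two of them come from divergences of periodic vector
  fields, namely \<open>\<rho> powr (- 2 b - 1) N \<nabla>\<rho>\<close> (lemma \<open>torus_integral_weighted_grad_sq_grad\<close>) and
  \<open>\<rho> powr (- 2 b) (D\<^sup>2\<rho> \<nabla>\<rho> - L \<nabla>\<rho>)\<close> (lemma \<open>torus_integral_weighted_hessian\<close>, a Bochner identity). They bring
  in two further quantities: \<open>Z\<close>, which is \<open>D\<^sup>2\<rho>(\<nabla>\<rho>, \<nabla>\<rho>)\<close> suitably weighted, and \<open>H\<close>, which is
  \<open>|D\<^sup>2\<rho>|\<^sup>2\<close> suitably weighted. These are tied to \<open>X\<close> and \<open>Y\<close> by \<open>matrix_sq_lower_bound\<close>, which expresses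
  that the squared norm of \<open>D\<^sup>2\<rho> - \<sigma> \<nabla>\<rho> \<otimes> \<nabla>\<rho>\<close> is at least the squared trace over the dimension.

  In \<open>form_lower_bound\<close> the two multipliers and the parameter \<open>\<sigma>\<close> are chosen so that the terms in \<open>X\<^sup>2\<close>,
  \<open>X Y\<close> and \<open>Z\<close> all cancel. What remains is a multiple of \<open>Y\<^sup>2\<close>, and its coefficient is positive
  precisely when \<open>b (2 d\<^sup>2 + 1) < d (d + 2)\<close>, which is the lower bound assumed on \<open>\<alpha>\<close>. Mixing in a little of
  the original form \<open>X\<^sup>2 - b X Y\<close> recovers the \<open>X\<^sup>2\<close> term (\<open>coercive_form\<close>).
\<close>

section \<open>Calculus of partial derivatives and smooth functions\<close>

lemma has_real_derivative_partial_deriv: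
  fixes f :: "real ^ 'n::finite \<Rightarrow> real"
  assumes "f differentiable (at (x + s *\<^sub>R axis i 1))"
  shows "((\<lambda>t. f (x + t *\<^sub>R axis i 1)) has_real_derivative
           partial_deriv i f (x + s *\<^sub>R axis i 1)) (at s)"
proof -
  obtain D where D: "(f has_derivative D) (at (x + s *\<^sub>R axis i 1))"
    using assms unfolding differentiable_def by blast
  interpret bounded_linear D
    using D by (rule has_derivative_bounded_linear)
  have line: "((\<lambda>t. f (z + t *\<^sub>R axis i 1)) has_real_derivative D (axis i 1)) (at u)"
    if "z + u *\<^sub>R axis i 1 = x + s *\<^sub>R axis i 1" for z :: "real ^ 'n" and u
  proof -
    have "((\<lambda>t. z + t *\<^sub>R axis i 1) has_derivative (\<lambda>t. t *\<^sub>R axis i 1)) (at u)"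
      by (auto intro!: derivative_eq_intros)
    from has_derivative_compose[OF this, of f D] D that
    show ?thesis
      by (simp add: has_field_derivative_def scaleR mult.commute[of _ "D (axis i 1)"])
  qed
  have "partial_deriv i f (x + s *\<^sub>R axis i 1) = D (axis i 1)"
    unfolding partial_deriv_def by (rule DERIV_imp_deriv, rule line) simp
  with line[of x s] show ?thesis by simp
qed

lemma partial_deriv_eqI:
  assumes "((\<lambda>t. f (x + t *\<^sub>R axis i 1)) has_real_derivative D) (at 0)"
  shows "partial_deriv i f x = D"
  unfolding partial_deriv_def using assms by (rule DERIV_imp_deriv)

lemma has_real_derivative_partial_deriv_0:
  "f differentiable (at x) \<Longrightarrow>
    ((\<lambda>t. f (x + t *\<^sub>R axis i 1)) has_real_derivative partial_deriv i f x) (at 0)"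
  using has_real_derivative_partial_deriv[of f x 0 i] by simp

lemma partial_deriv_add:
  assumes "f differentiable (at x)" "g differentiable (at x)"
  shows "partial_deriv i (\<lambda>x. f x + g x) x = partial_deriv i f x + partial_deriv i g x"
  by (rule partial_deriv_eqI)
    (intro DERIV_add has_real_derivative_partial_deriv_0 assms)

lemma partial_deriv_mult:
  assumes "f differentiable (at x)" "g differentiable (at x)"
  shows "partial_deriv i (\<lambda>x. f x * g x) x = partial_deriv i f x * g x + f x * partial_deriv i g x"
  by (rule partial_deriv_eqI)
    (use assms[THEN has_real_derivative_partial_deriv_0, of i] in
      \<open>auto intro!: derivative_eq_intros\<close>)

lemma partial_deriv_const: "partial_deriv i (\<lambda>x. c) x = 0"
  by (rule partial_deriv_eqI) simp

lemma partial_deriv_powr: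
  assumes "f differentiable (at x)" "f x > 0"
  shows "partial_deriv i (\<lambda>x. f x powr p) x = p * f x powr (p - 1) * partial_deriv i f x"
  by (rule partial_deriv_eqI)
    (use has_real_derivative_partial_deriv_0[OF assms(1), of i] assms(2) in
      \<open>auto intro!: derivative_eq_intros DERIV_fun_powr\<close>)

lemma differentiable_powr:
  fixes f :: "'a::real_normed_vector \<Rightarrow> real"
  assumes "f differentiable (at x)" "f x > 0"
  shows "(\<lambda>x. f x powr p) differentiable (at x)"
proof -
  obtain D where D: "(f has_derivative D) (at x)"
    using assms unfolding differentiable_def by blast
  show ?thesis
    unfolding differentiable_def
    by (rule exI, rule has_derivative_powr[OF D has_derivative_const]) (use assms in auto)
qed

text \<open>
  The classes \<^const>\<open>C_k\<close> decrease in \<open>k\<close>; the Leibniz and chain rules below need this because they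
  multiply a derivative of one factor by the other factor itself.
\<close>

lemma C_k_Suc_imp: "C_k (Suc k) f \<Longrightarrow> C_k k f"
  by (induction k arbitrary: f)
    (auto simp: continuous_on_eq_continuous_within differentiable_imp_continuous_within)

lemma C_k_const: "C_k k (\<lambda>x. c)"
  by (induction k arbitrary: c) (auto simp: partial_deriv_const[abs_def])

lemma C_k_add: "C_k k f \<Longrightarrow> C_k k g \<Longrightarrow> C_k k (\<lambda>x. f x + g x)"
proof (induction k arbitrary: f g)
  case 0
  then show ?case by (auto intro!: continuous_intros)
next
  case (Suc k)
  then have "partial_deriv i (\<lambda>x. f x + g x) = (\<lambda>x. partial_deriv i f x + partial_deriv i g x)" for i
    by (intro ext partial_deriv_add) auto
  with Suc show ?case by auto
qed

lemma C_k_mult: "C_k k f \<Longrightarrow> C_k k g \<Longrightarrow> C_k k (\<lambda>x. f x * g x)"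
proof (induction k arbitrary: f g)
  case 0
  then show ?case by (auto intro!: continuous_intros)
next
  case (Suc k)
  have "C_k k f" "C_k k g"
    using Suc.prems by (auto dest: C_k_Suc_imp simp del: C_k.simps)
  moreover have "partial_deriv i (\<lambda>x. f x * g x)
      = (\<lambda>x. partial_deriv i f x * g x + f x * partial_deriv i g x)" for i
    using Suc.prems by (intro ext partial_deriv_mult) auto
  ultimately show ?case
    using Suc by (auto intro!: C_k_add)
qed

text \<open>
  The exponent has to vary in the induction, since each differentiation lowers it by one.
\<close>

lemma C_k_powr:
  assumes pos: "\<And>x. f x > 0"
  shows "C_k k f \<Longrightarrow> C_k k (\<lambda>x. f x powr p)"
proof (induction k arbitrary: p)
  case 0
  have "f x \<noteq> 0" for x using pos[of x] by simp
  with 0 show ?case by (auto intro!: continuous_intros)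
next
  case (Suc k)
  have "C_k k f"
    using Suc.prems by (rule C_k_Suc_imp)
  moreover have "partial_deriv i (\<lambda>x. f x powr p)
      = (\<lambda>x. p * f x powr (p - 1) * partial_deriv i f x)" for i
    using Suc.prems pos by (intro ext partial_deriv_powr) auto
  ultimately show ?case
    using Suc pos by (auto intro!: C_k_mult C_k_const differentiable_powr)
qed

lemma smooth_differentiable: "smooth f \<Longrightarrow> f differentiable (at x)"
  unfolding smooth_def using C_k.simps(2) by blast

lemma smooth_continuous_on: "smooth f \<Longrightarrow> continuous_on S f"
  unfolding smooth_def by (metis C_k.simps(1) continuous_on_subset subset_UNIV)

lemma smooth_partial_deriv: "smooth f \<Longrightarrow> smooth (partial_deriv i f)"
  unfolding smooth_def using C_k.simps(2) by blast

lemma smooth_const: "smooth (\<lambda>x. c)"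
  by (simp add: smooth_def C_k_const)

lemma smooth_add: "smooth f \<Longrightarrow> smooth g \<Longrightarrow> smooth (\<lambda>x. f x + g x)"
  by (simp add: smooth_def C_k_add)

lemma smooth_mult: "smooth f \<Longrightarrow> smooth g \<Longrightarrow> smooth (\<lambda>x. f x * g x)"
  by (simp add: smooth_def C_k_mult)

lemma smooth_diff: "smooth f \<Longrightarrow> smooth g \<Longrightarrow> smooth (\<lambda>x. f x - g x)"
  using smooth_add[of f "\<lambda>x. (- 1) * g x"] smooth_mult[OF smooth_const[of "- 1"], of g] by simp

lemma smooth_powr: "smooth f \<Longrightarrow> (\<And>x. f x > 0) \<Longrightarrow> smooth (\<lambda>x. f x powr p)"
  by (simp add: smooth_def C_k_powr)

lemma smooth_sum:
  assumes "\<And>j. j \<in> J \<Longrightarrow> smooth (f j)"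
  shows "smooth (\<lambda>x. \<Sum>j\<in>J. f j x)"
proof -
  show ?thesis
    using assms
    by (induction J rule: infinite_finite_induct) (auto intro: smooth_const smooth_add)
qed

lemma smooth_laplacian: "smooth f \<Longrightarrow> smooth (laplacian f)"
  unfolding laplacian_def[abs_def] by (intro smooth_sum smooth_partial_deriv)

lemmas smooth_intros = smooth_const smooth_add smooth_mult smooth_diff smooth_powr smooth_sum
  smooth_partial_deriv smooth_laplacian

lemma partial_deriv_diff:
  assumes "f differentiable (at x)" "g differentiable (at x)"
  shows "partial_deriv i (\<lambda>x. f x - g x) x = partial_deriv i f x - partial_deriv i g x"
  by (rule partial_deriv_eqI)
    (intro DERIV_diff has_real_derivative_partial_deriv_0 assms)

lemma partial_deriv_sum:
  assumes "\<And>j. j \<in> J \<Longrightarrow> f j differentiable (at x)"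
  shows "partial_deriv i (\<lambda>x. \<Sum>j\<in>J. f j x) x = (\<Sum>j\<in>J. partial_deriv i (f j) x)"
  by (rule partial_deriv_eqI)
    (intro DERIV_sum has_real_derivative_partial_deriv_0 assms)

section \<open>Symmetry of second derivatives\<close>

lemma partial_deriv_mean_value:
  assumes "\<And>x. f differentiable (at x)" "h > 0"
  obtains s where "0 < s" "s < h"
    "f (x + h *\<^sub>R axis i 1) - f x = h * partial_deriv i f (x + s *\<^sub>R axis i 1)"
proof -
  obtain s where "s > 0" "s < h" and
    "f (x + h *\<^sub>R axis i 1) - f (x + 0 *\<^sub>R axis i 1)
      = (h - 0) * partial_deriv i f (x + s *\<^sub>R axis i 1)"
    using MVT2[OF assms(2), of "\<lambda>t. f (x + t *\<^sub>R axis i 1)"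
        "\<lambda>s. partial_deriv i f (x + s *\<^sub>R axis i 1)"]
      has_real_derivative_partial_deriv[OF assms(1)] by blast
  then show ?thesis using that by simp
qed

lemma differentiable_shift:
  assumes "\<And>x. f differentiable (at x)"
  shows "(\<lambda>x. f (x + c)) differentiable (at x)"
proof -
  obtain D where "(f has_derivative D) (at (x + c))"
    using assms unfolding differentiable_def by blast
  moreover have "((\<lambda>x. x + c) has_derivative (\<lambda>x. x)) (at x)"
    by (auto intro!: derivative_eq_intros)
  ultimately have "((\<lambda>x. f (x + c)) has_derivative (\<lambda>x. D x)) (at x)"
    using has_derivative_compose by blast
  then show ?thesis unfolding differentiable_def by blast
qed

lemma partial_deriv_shift: "partial_deriv i (\<lambda>x. f (x + c)) x = partial_deriv i f (x + c)"
  by (simp add: partial_deriv_def add_ac)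

text \<open>
  The second difference over a small parallelogram is symmetric in the two directions, while two
  applications of the mean value theorem, first in direction \<open>i\<close> and then in direction \<open>j\<close>, express it
  by the second derivative in that order. Comparing both orders gives the symmetry of second
  derivatives.
\<close>

lemma second_difference_mean_value:
  assumes f: "\<And>x. f differentiable (at x)" and f': "\<And>x. partial_deriv i f differentiable (at x)"
    and "h > 0"
  obtains s t where "0 < s" "s < h" "0 < t" "t < h"
    "f (x + h *\<^sub>R axis i 1 + h *\<^sub>R axis j 1) - f (x + h *\<^sub>R axis i 1)
       - f (x + h *\<^sub>R axis j 1) + f x
     = h\<^sup>2 * partial_deriv j (partial_deriv i f) (x + s *\<^sub>R axis i 1 + t *\<^sub>R axis j 1)"
proof -
  define g where "g = (\<lambda>x. f (x + h *\<^sub>R axis j 1) - f x)"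
  have g: "g differentiable (at x)" for x
    unfolding g_def by (intro differentiable_diff differentiable_shift f)
  have pg: "partial_deriv i g x = partial_deriv i f (x + h *\<^sub>R axis j 1) - partial_deriv i f x" for x
    unfolding g_def
    by (subst partial_deriv_diff) (auto intro!: differentiable_shift f simp: partial_deriv_shift)
  obtain s where s: "0 < s" "s < h"
      "g (x + h *\<^sub>R axis i 1) - g x = h * partial_deriv i g (x + s *\<^sub>R axis i 1)"
    using partial_deriv_mean_value[of g h x i] g \<open>h > 0\<close> by blast
  obtain t where t: "0 < t" "t < h"
      "partial_deriv i f (x + s *\<^sub>R axis i 1 + h *\<^sub>R axis j 1) - partial_deriv i f (x + s *\<^sub>R axis i 1)
        = h * partial_deriv j (partial_deriv i f) (x + s *\<^sub>R axis i 1 + t *\<^sub>R axis j 1)"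
    using partial_deriv_mean_value[of "partial_deriv i f" h "x + s *\<^sub>R axis i 1" j] f' \<open>h > 0\<close>
    by blast
  have "g (x + h *\<^sub>R axis i 1) - g x
      = h\<^sup>2 * partial_deriv j (partial_deriv i f) (x + s *\<^sub>R axis i 1 + t *\<^sub>R axis j 1)"
    unfolding s(3) pg t(3) by (simp add: power2_eq_square)
  then show ?thesis
    using that[OF s(1,2) t(1,2)] by (simp add: g_def algebra_simps)
qed

text \<open>
  If the two mixed derivatives differed at \<open>x\<close>, then by continuity their values would be separated on a
  whole neighbourhood of \<open>x\<close>, against the coincidence of the two mean values.
\<close>

lemma partial_deriv_commute:
  fixes f :: "real ^ 'n \<Rightarrow> real"
  assumes f: "smooth f"
  shows "partial_deriv i (partial_deriv j f) x = partial_deriv j (partial_deriv i f) x"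
proof (rule ccontr)
  let ?A = "partial_deriv j (partial_deriv i f)" and ?B = "partial_deriv i (partial_deriv j f)"
  assume neq: "\<not> ?thesis"
  define e where "e = \<bar>?A x - ?B x\<bar> / 2"
  have e: "e > 0" using neq by (simp add: e_def)
  have cont: "continuous (at x) ?A" "continuous (at x) ?B"
    using f by (auto intro!: differentiable_imp_continuous_within smooth_differentiable smooth_intros)
  obtain \<delta>1 where d1: "\<delta>1 > 0" "\<And>y. dist y x < \<delta>1 \<Longrightarrow> dist (?A y) (?A x) < e"
    using cont(1) e unfolding continuous_at_eps_delta by blast
  obtain \<delta>2 where d2: "\<delta>2 > 0" "\<And>y. dist y x < \<delta>2 \<Longrightarrow> dist (?B y) (?B x) < e"
    using cont(2) e unfolding continuous_at_eps_delta by blast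
  \<comment> \<open>The intermediate points are at distance less than \<open>2 * h\<close> from \<open>x\<close>.\<close>
  define h where "h = min \<delta>1 \<delta>2 / 2"
  have h: "h > 0" using d1 d2 by (simp add: h_def)
  have near: "dist (x + s *\<^sub>R axis k 1 + t *\<^sub>R axis l 1) x < 2 * h"
    if "0 < s" "s < h" "0 < t" "t < h" for s t and k l :: 'n
    using that norm_triangle_ineq[of "s *\<^sub>R axis k 1" "t *\<^sub>R axis l (1::real)"]
    by (simp add: dist_norm add.assoc)
  note diffs = smooth_differentiable[OF f] smooth_differentiable[OF smooth_partial_deriv[OF f]]
  obtain s t where st: "0 < s" "s < h" "0 < t" "t < h" and
    1: "f (x + h *\<^sub>R axis i 1 + h *\<^sub>R axis j 1) - f (x + h *\<^sub>R axis i 1)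
       - f (x + h *\<^sub>R axis j 1) + f x
      = h\<^sup>2 * ?A (x + s *\<^sub>R axis i 1 + t *\<^sub>R axis j 1)"
    using second_difference_mean_value[OF diffs h] by blast
  obtain s' t' where st': "0 < s'" "s' < h" "0 < t'" "t' < h" and
    2: "f (x + h *\<^sub>R axis j 1 + h *\<^sub>R axis i 1) - f (x + h *\<^sub>R axis j 1)
       - f (x + h *\<^sub>R axis i 1) + f x
      = h\<^sup>2 * ?B (x + s' *\<^sub>R axis j 1 + t' *\<^sub>R axis i 1)"
    using second_difference_mean_value[OF diffs h] by blast
  have "h\<^sup>2 * ?A (x + s *\<^sub>R axis i 1 + t *\<^sub>R axis j 1)
      = h\<^sup>2 * ?B (x + s' *\<^sub>R axis j 1 + t' *\<^sub>R axis i 1)"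
    unfolding 1[symmetric] 2[symmetric] by (simp add: algebra_simps)
  then have "?A (x + s *\<^sub>R axis i 1 + t *\<^sub>R axis j 1) = ?B (x + s' *\<^sub>R axis j 1 + t' *\<^sub>R axis i 1)"
    using h by simp
  moreover have "dist (?A (x + s *\<^sub>R axis i 1 + t *\<^sub>R axis j 1)) (?A x) < e"
    using near[OF st, of i j] by (intro d1) (simp add: h_def)
  moreover have "dist (?B (x + s' *\<^sub>R axis j 1 + t' *\<^sub>R axis i 1)) (?B x) < e"
    using near[OF st', of j i] by (intro d2) (simp add: h_def)
  ultimately have "\<bar>?A x - ?B x\<bar> < 2 * e"
    by (simp add: dist_real_def)
  then show False by (simp add: e_def)
qed

section \<open>Translation invariance of the torus integral\<close>

lemma torus_fun_partial_deriv: "torus_fun f \<Longrightarrow> torus_fun (partial_deriv i f)"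
  by (simp add: torus_fun_def partial_deriv_def add.assoc[symmetric] add.commute[of _ "axis _ 1"])
     (simp add: add.assoc)

lemma torus_fun_laplacian: "torus_fun f \<Longrightarrow> torus_fun (laplacian f)"
  using torus_fun_partial_deriv[OF torus_fun_partial_deriv, of f]
  unfolding torus_fun_def laplacian_def by (intro allI sum.cong) auto

text \<open>
  The unit cube with its side in direction \<open>i\<close> replaced by \<open>[s, t]\<close>. The upper corner is
  \<open>1 + (t - 1) e\<^sub>i\<close>, whose \<open>i\<close>-th coordinate is \<open>t\<close>.
\<close>

definition slab :: "'n::finite \<Rightarrow> real \<Rightarrow> real \<Rightarrow> (real ^ 'n) set" where
  "slab i s t = cbox (s *\<^sub>R axis i 1) (1 + (t - 1) *\<^sub>R axis i 1)"

lemma mem_slab: "x \<in> slab i s t \<longleftrightarrow> s \<le> x $ i \<and> x $ i \<le> t \<and> (\<forall>j. j \<noteq> i \<longrightarrow> 0 \<le> x $ j \<and> x $ j \<le> 1)"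
  unfolding slab_def mem_box_cart by (auto simp: axis_def split: if_splits)

lemma integral_slab_combine:
  assumes "continuous_on UNIV f" "s \<le> c" "c \<le> t"
  shows "integral (slab i s t) f = integral (slab i s c) f + integral (slab i c t) (f :: _ \<Rightarrow> real)"
proof -
  have int: "f integrable_on slab i u v" for u v
    unfolding slab_def by (rule integrable_continuous) (rule continuous_on_subset[OF assms(1)], simp)
  have "slab i s t \<inter> {x. x \<bullet> axis i 1 \<le> c} = slab i s c"
       "slab i s t \<inter> {x. x \<bullet> axis i 1 \<ge> c} = slab i c t"
    using assms(2,3) by (auto simp: mem_slab inner_axis)
  then show ?thesis
    using has_integral_split[of f _ "s *\<^sub>R axis i 1" "1 + (t - 1) *\<^sub>R axis i 1" "axis i 1" c]
      int[THEN integrable_integral, of s c] int[THEN integrable_integral, of c t]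
    by (auto simp: slab_def[symmetric] axis_in_Basis_iff intro!: integral_unique)
qed

text \<open>
  Cutting the slab over \<open>[0, 1 + t]\<close> once at \<open>1\<close> and once at \<open>t\<close> gives two decompositions. The piece over
  \<open>[1, 1 + t]\<close> of the first is a lattice translate of the piece over \<open>[0, t]\<close> of the second, so the
  other two pieces, the unit cube and its translate by \<open>t\<close>, have the same integral.
\<close>

lemma torus_integral_shift:
  assumes per: "torus_fun f" and cont: "continuous_on UNIV f" and t: "0 \<le> t" "t \<le> 1"
  shows "torus_integral (\<lambda>x. f (x + t *\<^sub>R axis i 1)) = torus_integral f"
proof -
  have shift: "integral (slab i (s + c) (u + c)) f = integral (slab i s u) (\<lambda>x. f (x + c *\<^sub>R axis i 1))"
    for s u c
    unfolding slab_def
    using integral_shift_cbox_plus[of "s *\<^sub>R axis i 1" "1 + (u - 1) *\<^sub>R axis i 1" f "c *\<^sub>R axis i 1"]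
    by (simp add: o_def algebra_simps)
  have unit: "slab i 0 1 = cbox 0 1"
    by (auto simp: slab_def)
  have "integral (slab i 0 1) f + integral (slab i 1 (1 + t)) f
      = integral (slab i 0 t) f + integral (slab i t (1 + t)) f"
    using integral_slab_combine[OF cont, of 0 1 "1 + t" i]
      integral_slab_combine[OF cont, of 0 t "1 + t" i] t by simp
  moreover have "integral (slab i 1 (1 + t)) f = integral (slab i 0 t) f"
    using shift[of 0 1 t] per by (simp add: torus_fun_def add.commute)
  ultimately have "integral (slab i t (1 + t)) f = integral (slab i 0 1) f"
    by simp
  then show ?thesis
    using shift[of 0 t 1] unit by (simp add: torus_integral_def)
qed

text \<open>
  The integral of the translated function does not depend on the translation; differentiating it
  under the integral sign at translation \<open>0\<close> gives the claim.
\<close>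

lemma torus_integral_partial_deriv:
  fixes f :: "real ^ 'n \<Rightarrow> real"
  assumes per: "torus_fun f" and f: "smooth f"
  shows "torus_integral (partial_deriv i f) = 0"
proof -
  let ?g = "partial_deriv i f"
  have "((\<lambda>t. integral (cbox 0 1) (\<lambda>x. f (x + t *\<^sub>R axis i 1))) has_real_derivative
      integral (cbox 0 1) (\<lambda>x. ?g (x + 0 *\<^sub>R axis i 1))) (at 0 within {0..1})"
  proof (rule leibniz_rule_field_derivative)
    show "((\<lambda>t. f (x + t *\<^sub>R axis i 1)) has_real_derivative ?g (x + t *\<^sub>R axis i 1)) (at t within {0..1})"
      for t x
      by (rule has_field_derivative_at_within)
        (rule has_real_derivative_partial_deriv[OF smooth_differentiable[OF f]])
    show "(\<lambda>x. f (x + t *\<^sub>R axis i 1)) integrable_on cbox 0 1" for t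
      by (rule integrable_continuous)
        (intro continuous_on_compose2[OF smooth_continuous_on[OF f, of UNIV]] continuous_intros, simp)
    show "continuous_on ({0..1} \<times> cbox 0 1) (\<lambda>(t, x). ?g (x + t *\<^sub>R axis i 1))"
      unfolding case_prod_unfold
      by (intro continuous_on_compose2[OF smooth_continuous_on[OF smooth_partial_deriv[OF f], of UNIV]]
          continuous_intros) simp
  qed auto
  moreover have "integral (cbox 0 1) (\<lambda>x. f (x + t *\<^sub>R axis i 1)) = torus_integral f"
    if "t \<in> {0..1}" for t
    using torus_integral_shift[OF per smooth_continuous_on[OF f]] that
    by (simp add: torus_integral_def)
  ultimately have "((\<lambda>t. torus_integral f) has_real_derivative torus_integral ?g) (at 0 within {0..1})"
    by (subst (asm) has_field_derivative_cong_eventually[where g = "\<lambda>t. torus_integral f"])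
      (auto simp: torus_integral_def eventually_at intro!: exI[of _ 1])
  moreover have "((\<lambda>t. torus_integral f) has_real_derivative 0) (at 0 within {0..1})"
    by simp
  ultimately show ?thesis
    by (rule has_field_derivative_unique) (simp add: trivial_limit_within islimpt_Icc)
qed

section \<open>Divergence theorem and integration by parts\<close>

lemma torus_fun_mult: "torus_fun f \<Longrightarrow> torus_fun g \<Longrightarrow> torus_fun (\<lambda>x. f x * g x)"
  by (simp add: torus_fun_def)

lemma torus_fun_diff: "torus_fun f \<Longrightarrow> torus_fun g \<Longrightarrow> torus_fun (\<lambda>x. f x - g x)"
  by (simp add: torus_fun_def)

lemma torus_fun_powr: "torus_fun f \<Longrightarrow> torus_fun (\<lambda>x. f x powr p)"
  by (simp add: torus_fun_def)

lemma torus_fun_sum: "(\<And>j. j \<in> J \<Longrightarrow> torus_fun (f j)) \<Longrightarrow> torus_fun (\<lambda>x. \<Sum>j\<in>J. f j x)"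
  by (simp add: torus_fun_def)

lemmas torus_fun_intros = torus_fun_mult torus_fun_diff torus_fun_powr torus_fun_sum
  torus_fun_partial_deriv torus_fun_laplacian

lemma smooth_integrable: "smooth f \<Longrightarrow> f integrable_on cbox a b"
  by (intro integrable_continuous smooth_continuous_on)

lemma torus_integral_divergence:
  fixes V :: "'n::finite \<Rightarrow> real ^ 'n \<Rightarrow> real"
  assumes "\<And>i. torus_fun (V i)" "\<And>i. smooth (V i)"
  shows "torus_integral (\<lambda>x. \<Sum>i\<in>UNIV. partial_deriv i (V i) x) = 0"
proof -
  have "torus_integral (\<lambda>x. \<Sum>i\<in>UNIV. partial_deriv i (V i) x)
      = (\<Sum>i\<in>UNIV. torus_integral (partial_deriv i (V i)))"
    unfolding torus_integral_def
    by (rule integral_sum) (auto intro!: smooth_integrable smooth_partial_deriv assms)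
  then show ?thesis by (simp add: torus_integral_partial_deriv assms)
qed

lemma torus_integral_grad_inner_grad:
  fixes f g :: "real ^ 'n::finite \<Rightarrow> real"
  assumes "torus_fun f" "smooth f" "torus_fun g" "smooth g"
  shows "torus_integral (\<lambda>x. grad f x \<bullet> grad g x) = - torus_integral (\<lambda>x. laplacian f x * g x)"
proof -
  have "(\<Sum>i\<in>UNIV. partial_deriv i (\<lambda>x. partial_deriv i f x * g x) x)
      = laplacian f x * g x + grad f x \<bullet> grad g x" for x
    using assms
    by (simp add: partial_deriv_mult smooth_differentiable smooth_intros sum.distrib
        laplacian_def grad_def inner_vec_def sum_distrib_right)
  then have "torus_integral (\<lambda>x. laplacian f x * g x + grad f x \<bullet> grad g x) = 0"
    using torus_integral_divergence[of "\<lambda>i x. partial_deriv i f x * g x"] assms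
    by (simp add: smooth_intros torus_fun_intros)
  moreover have "smooth (\<lambda>x. laplacian f x * g x)" "smooth (\<lambda>x. grad f x \<bullet> grad g x)"
    using assms by (auto simp: grad_def inner_vec_def intro!: smooth_intros)
  ultimately show ?thesis
    by (simp add: torus_integral_def integral_add smooth_integrable)
qed

section \<open>Two weighted integral identities\<close>

definition grad_sq :: "(real ^ 'n::finite \<Rightarrow> real) \<Rightarrow> real ^ 'n \<Rightarrow> real" where
  "grad_sq f x = (\<Sum>i\<in>UNIV. (partial_deriv i f x)\<^sup>2)"

definition hessian_sq :: "(real ^ 'n::finite \<Rightarrow> real) \<Rightarrow> real ^ 'n \<Rightarrow> real" where
  "hessian_sq f x = (\<Sum>i\<in>UNIV. \<Sum>j\<in>UNIV. (partial_deriv i (partial_deriv j f) x)\<^sup>2)"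

definition hessian_grad_grad :: "(real ^ 'n::finite \<Rightarrow> real) \<Rightarrow> real ^ 'n \<Rightarrow> real" where
  "hessian_grad_grad f x =
    (\<Sum>i\<in>UNIV. \<Sum>j\<in>UNIV. partial_deriv i (partial_deriv j f) x * partial_deriv i f x * partial_deriv j f x)"

lemma smooth_grad_sq: "smooth f \<Longrightarrow> smooth (grad_sq f)"
  unfolding grad_sq_def[abs_def] power2_eq_square by (intro smooth_intros)

lemma smooth_hessian_sq: "smooth f \<Longrightarrow> smooth (hessian_sq f)"
  unfolding hessian_sq_def[abs_def] power2_eq_square by (intro smooth_intros)

lemma smooth_hessian_grad_grad: "smooth f \<Longrightarrow> smooth (hessian_grad_grad f)"
  unfolding hessian_grad_grad_def[abs_def] by (intro smooth_intros)

lemma torus_fun_grad_sq: "torus_fun f \<Longrightarrow> torus_fun (grad_sq f)"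
  using torus_fun_partial_deriv[of f] unfolding torus_fun_def grad_sq_def by simp

lemma partial_deriv_grad_sq:
  assumes "smooth f"
  shows "partial_deriv i (grad_sq f) x
    = 2 * (\<Sum>j\<in>UNIV. partial_deriv i (partial_deriv j f) x * partial_deriv j f x)"
  unfolding grad_sq_def[abs_def] power2_eq_square using assms
  by (simp add: partial_deriv_sum partial_deriv_mult smooth_differentiable smooth_intros
      sum_distrib_left mult_ac)

text \<open>
  The integrand is the divergence of \<open>\<rho>\<^sup>p |\<nabla>\<rho>|\<^sup>2 \<nabla>\<rho>\<close>.
\<close>

lemma torus_integral_weighted_grad_sq_grad:
  assumes per: "torus_fun \<rho>" and sm: "smooth \<rho>" and pos: "\<And>x. \<rho> x > 0"
  shows "torus_integral (\<lambda>x. p * \<rho> x powr (p - 1) * (grad_sq \<rho> x)\<^sup>2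
      + \<rho> x powr p * (grad_sq \<rho> x * laplacian \<rho> x + 2 * hessian_grad_grad \<rho> x)) = 0"
proof -
  define V where "V = (\<lambda>i x. \<rho> x powr p * (grad_sq \<rho> x * partial_deriv i \<rho> x))"
  note smooths = sm pos smooth_intros smooth_grad_sq
  have div: "partial_deriv i (V i) x =
      p * \<rho> x powr (p - 1) * (grad_sq \<rho> x * (partial_deriv i \<rho> x)\<^sup>2)
      + \<rho> x powr p * (grad_sq \<rho> x * partial_deriv i (partial_deriv i \<rho>) x
        + 2 * (\<Sum>j\<in>UNIV. partial_deriv i (partial_deriv j \<rho>) x * partial_deriv i \<rho> x * partial_deriv j \<rho> x))"
    for i x
    unfolding V_def
    by (simp add: partial_deriv_mult partial_deriv_powr smooth_differentiable smooths
        partial_deriv_grad_sq sum_distrib_left sum_distrib_right power2_eq_square algebra_simps)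
  have "(\<Sum>i\<in>UNIV. partial_deriv i (V i) x) =
      p * \<rho> x powr (p - 1) * (grad_sq \<rho> x)\<^sup>2
      + \<rho> x powr p * (grad_sq \<rho> x * laplacian \<rho> x + 2 * hessian_grad_grad \<rho> x)" for x
    unfolding div
    by (simp add: sum.distrib sum_distrib_left[symmetric] grad_sq_def[of \<rho> x, symmetric]
        laplacian_def[symmetric] hessian_grad_grad_def[symmetric] power2_eq_square[of "grad_sq \<rho> x"])
  moreover have "torus_integral (\<lambda>x. \<Sum>i\<in>UNIV. partial_deriv i (V i) x) = 0"
    unfolding V_def
    by (intro torus_integral_divergence smooths torus_fun_intros torus_fun_grad_sq per)
  ultimately show ?thesis by simp
qed

text \<open>
  The integrand is the divergence of \<open>\<rho>\<^sup>p (D\<^sup>2\<rho> \<nabla>\<rho> - \<Delta>\<rho> \<nabla>\<rho>)\<close>. The choice of this field is what keeps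
  third derivatives out: they occur as \<open>\<nabla>(\<Delta>\<rho>) \<cdot> \<nabla>\<rho>\<close> with both signs, once partial derivatives are
  interchanged. For \<open>p = 0\<close> this is the integrated Bochner formula, by which the Hessian and the
  Laplacian have the same norm in \<open>L\<^sup>2\<close>.
\<close>

lemma torus_integral_weighted_hessian:
  assumes per: "torus_fun \<rho>" and sm: "smooth \<rho>" and pos: "\<And>x. \<rho> x > 0"
  shows "torus_integral (\<lambda>x. p * \<rho> x powr (p - 1) * (hessian_grad_grad \<rho> x - grad_sq \<rho> x * laplacian \<rho> x)
      + \<rho> x powr p * (hessian_sq \<rho> x - (laplacian \<rho> x)\<^sup>2)) = 0"
proof -
  let ?u = "\<lambda>i. partial_deriv i \<rho>"
  let ?u2 = "\<lambda>i j. partial_deriv i (partial_deriv j \<rho>)"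
  define V where "V = (\<lambda>i x. \<rho> x powr p * ((\<Sum>j\<in>UNIV. ?u2 i j x * ?u j x) - laplacian \<rho> x * ?u i x))"
  note smooths = sm pos smooth_intros
  have third: "partial_deriv i (?u2 i j) x = partial_deriv j (?u2 i i) x" for i j x
  proof -
    have "?u2 i j = ?u2 j i"
      using partial_deriv_commute[OF sm] by blast
    then show ?thesis
      using partial_deriv_commute[OF smooth_partial_deriv[OF sm]] by metis
  qed
  have div: "partial_deriv i (V i) x =
      p * \<rho> x powr (p - 1) * ((\<Sum>j\<in>UNIV. ?u2 i j x * ?u i x * ?u j x) - laplacian \<rho> x * (?u i x)\<^sup>2)
      + \<rho> x powr p * ((\<Sum>j\<in>UNIV. (?u2 i j x)\<^sup>2) - laplacian \<rho> x * ?u2 i i x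
        + ((\<Sum>j\<in>UNIV. partial_deriv j (?u2 i i) x * ?u j x) - partial_deriv i (laplacian \<rho>) x * ?u i x))"
    for i x
    unfolding V_def
    by (simp add: partial_deriv_mult partial_deriv_powr partial_deriv_diff partial_deriv_sum
        smooth_differentiable smooths third sum.distrib
        sum_distrib_left sum_distrib_right power2_eq_square algebra_simps)
  have cancel: "(\<Sum>i\<in>UNIV. \<Sum>j\<in>UNIV. partial_deriv j (?u2 i i) x * ?u j x)
      = (\<Sum>i\<in>UNIV. partial_deriv i (laplacian \<rho>) x * ?u i x)" for x
    unfolding laplacian_def[abs_def]
    by (subst sum.swap) (simp add: partial_deriv_sum smooth_differentiable smooths sum_distrib_right)
  have "(\<Sum>i\<in>UNIV. partial_deriv i (V i) x) =
      p * \<rho> x powr (p - 1) * (hessian_grad_grad \<rho> x - grad_sq \<rho> x * laplacian \<rho> x)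
      + \<rho> x powr p * (hessian_sq \<rho> x - (laplacian \<rho> x)\<^sup>2)" for x
    unfolding div
    by (simp add: sum.distrib sum_subtractf sum_distrib_left[symmetric] cancel
        grad_sq_def[symmetric] hessian_sq_def[symmetric]
        laplacian_def[of \<rho> x, symmetric] hessian_grad_grad_def[symmetric]
        power2_eq_square[of "laplacian \<rho> x"] mult.commute[of "laplacian \<rho> x" "grad_sq \<rho> x"])
  moreover have "torus_integral (\<lambda>x. \<Sum>i\<in>UNIV. partial_deriv i (V i) x) = 0"
    unfolding V_def
    by (intro torus_integral_divergence smooths torus_fun_intros per)
  ultimately show ?thesis by simp
qed

section \<open>The pointwise inequality\<close>

text \<open>
  The difference of both sides is the sum of squares of the entries of the trace-free part of
  \<open>M - \<sigma> v \<otimes> v\<close>. Keeping \<open>\<sigma>\<close> free replaces an explicit splitting of \<open>M\<close> along \<open>v\<close>, which would need \<open>v\<close> to be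
  nonzero.
\<close>

lemma matrix_sq_lower_bound:
  fixes M :: "'n::finite \<Rightarrow> 'n \<Rightarrow> real" and v :: "'n \<Rightarrow> real"
  defines "T \<equiv> \<Sum>i\<in>UNIV. M i i" and "N \<equiv> \<Sum>i\<in>UNIV. (v i)\<^sup>2"
  shows "(\<Sum>i\<in>UNIV. \<Sum>j\<in>UNIV. (M i j)\<^sup>2)
    \<ge> 2 * \<sigma> * (\<Sum>i\<in>UNIV. \<Sum>j\<in>UNIV. M i j * v i * v j) - \<sigma>\<^sup>2 * N\<^sup>2 + (T - \<sigma> * N)\<^sup>2 / real CARD('n)"
proof -
  \<comment> \<open>The constant diagonal that makes \<open>M - \<sigma> v \<otimes> v\<close> trace-free.\<close>
  define e where "e = (T - \<sigma> * N) / real CARD('n)"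
  have "(\<Sum>i\<in>UNIV. \<Sum>j\<in>UNIV. (M i j - \<sigma> * (v i * v j) - (if i = j then e else 0))\<^sup>2)
      = (\<Sum>i\<in>UNIV. \<Sum>j\<in>UNIV. (M i j)\<^sup>2 - 2 * \<sigma> * (M i j * v i * v j) + \<sigma>\<^sup>2 * ((v i)\<^sup>2 * (v j)\<^sup>2)
          + (if i = j then e\<^sup>2 - 2 * e * (M i i - \<sigma> * (v i)\<^sup>2) else 0))"
    by (intro sum.cong refl) (auto simp: power2_eq_square algebra_simps)
  also have "\<dots> = (\<Sum>i\<in>UNIV. \<Sum>j\<in>UNIV. (M i j)\<^sup>2)
      - 2 * \<sigma> * (\<Sum>i\<in>UNIV. \<Sum>j\<in>UNIV. M i j * v i * v j) + \<sigma>\<^sup>2 * N\<^sup>2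
      + (real CARD('n) * e\<^sup>2 - 2 * e * (T - \<sigma> * N))"
    by (simp add: sum.distrib sum_subtractf sum_distrib_left[symmetric] sum_distrib_right[symmetric]
        N_def[symmetric] T_def[symmetric] power2_eq_square[of N])
  also have "real CARD('n) * e\<^sup>2 - 2 * e * (T - \<sigma> * N) = - (T - \<sigma> * N)\<^sup>2 / real CARD('n)"
    by (simp add: e_def power2_eq_square)
  finally show ?thesis
    using sum_nonneg[of UNIV "\<lambda>i. \<Sum>j\<in>UNIV. (M i j - \<sigma> * (v i * v j) - (if i = j then e else 0))\<^sup>2"]
    by (simp add: sum_nonneg)
qed

text \<open>
  With the bound for \<open>H\<close> inserted, the right-hand side is a quadratic form in \<open>X\<close>, \<open>Y\<close> plus a multiple of
  \<open>Z\<close>. The value of \<open>\<mu>\<close> is forced by the vanishing of the \<open>X\<^sup>2\<close> coefficient, and \<open>\<mu> s = \<nu> + \<mu> b\<close> by that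
  of the \<open>Z\<close> coefficient; \<open>\<nu>\<close> is then determined by the vanishing of the \<open>X Y\<close> coefficient. The
  coefficient of \<open>Y\<^sup>2\<close> that is left is \<open>\<nu> (1 + 2 b) - s\<^sup>2\<close>.
\<close>

lemma form_lower_bound:
  fixes b d X Y Z H :: real
  assumes d: "d > 1"
  defines "\<mu> \<equiv> d / (d - 1)" and "\<nu> \<equiv> b * d / (d + 2)" and "s \<equiv> b * (2 * d + 1) / (d + 2)"
  assumes H: "H \<ge> 2 * s * Z - s\<^sup>2 * Y\<^sup>2 + (X - s * Y)\<^sup>2 / d"
  shows "b * (d * (d + 2) - b * (2 * d\<^sup>2 + 1)) / (d + 2)\<^sup>2 * Y\<^sup>2
    \<le> X\<^sup>2 - b * X * Y - \<nu> * (X * Y + 2 * Z - (1 + 2 * b) * Y\<^sup>2)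
      + \<mu> * (H - X\<^sup>2 - 2 * b * (Z - X * Y))"
proof -
  have \<mu>: "\<mu> > 0" using d by (simp add: \<mu>_def)
  have nz: "d - 1 \<noteq> 0" "d + 2 \<noteq> 0" "d \<noteq> 0" using d by auto
  have "X\<^sup>2 - b * X * Y - \<nu> * (X * Y + 2 * Z - (1 + 2 * b) * Y\<^sup>2)
      + \<mu> * (2 * s * Z - s\<^sup>2 * Y\<^sup>2 + (X - s * Y)\<^sup>2 / d - X\<^sup>2 - 2 * b * (Z - X * Y))
    = (1 + \<mu> / d - \<mu>) * X\<^sup>2 + (2 * b * \<mu> - 2 * s * (\<mu> / d) - \<nu> - b) * (X * Y)
      + 2 * (\<mu> * s - \<nu> - \<mu> * b) * Z + (\<nu> * (1 + 2 * b) - s\<^sup>2 * (\<mu> - \<mu> / d)) * Y\<^sup>2"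
    using nz(3) by (simp add: power2_eq_square field_simps)
  also have "1 + \<mu> / d - \<mu> = 0"
    using nz by (simp add: \<mu>_def field_simps)
  also have "2 * b * \<mu> - 2 * s * (\<mu> / d) - \<nu> - b = 0"
    using nz by (simp add: \<mu>_def \<nu>_def s_def divide_simps) (simp add: algebra_simps)
  also have "\<mu> * s - \<nu> - \<mu> * b = 0"
    using nz by (simp add: \<mu>_def \<nu>_def s_def divide_simps) (simp add: algebra_simps)
  also have "\<nu> * (1 + 2 * b) - s\<^sup>2 * (\<mu> - \<mu> / d)
      = b * (d * (d + 2) - b * (2 * d\<^sup>2 + 1)) / (d + 2)\<^sup>2"
  proof -
    have "\<mu> - \<mu> / d = (d - 1) / (d - 1)"
      unfolding diff_divide_distrib using nz by (simp add: \<mu>_def)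
    then have "\<mu> - \<mu> / d = 1" using nz by simp
    then show ?thesis
      using nz by (simp add: \<nu>_def s_def divide_simps) (simp add: algebra_simps power2_eq_square)
  qed
  finally show ?thesis
    using mult_left_mono[OF H, of \<mu>] \<mu> by (simp add: algebra_simps)
qed

text \<open>
  The bound by \<open>Y\<^sup>2\<close> of the preceding lemma and the elementary bound
  \<open>X\<^sup>2 - b X Y \<ge> X\<^sup>2 / 2 - b\<^sup>2 Y\<^sup>2 / 2\<close> are averaged, with a weight on the second one that is small
  enough for the coefficient of \<open>Y\<^sup>2\<close> to stay positive.
\<close>

lemma coercive_form:
  fixes b d :: real
  assumes d: "d > 1" and b: "0 < b" "b * (2 * d\<^sup>2 + 1) < d * (d + 2)"
  shows "\<exists>C>0. \<exists>\<kappa> \<mu> s. \<forall>X Y Z H.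
    H \<ge> 2 * s * Z - s\<^sup>2 * Y\<^sup>2 + (X - s * Y)\<^sup>2 / d \<longrightarrow>
    C * (X\<^sup>2 + Y\<^sup>2) \<le> X\<^sup>2 - b * X * Y + \<kappa> * (X * Y + 2 * Z - (1 + 2 * b) * Y\<^sup>2)
      + \<mu> * (H - X\<^sup>2 - 2 * b * (Z - X * Y))"
proof -
  define c where "c = b * (d * (d + 2) - b * (2 * d\<^sup>2 + 1)) / (d + 2)\<^sup>2"
  have c: "c > 0" using assms by (simp add: c_def)
  \<comment> \<open>This weight gives \<open>X\<^sup>2\<close> and \<open>Y\<^sup>2\<close> the same coefficient \<open>t / 2\<close>.\<close>
  define t where "t = c / (c + b\<^sup>2 / 2 + 1 / 2)"
  have den: "c + b\<^sup>2 / 2 + 1 / 2 > 0" using c by (simp add: add_pos_nonneg)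
  have t: "0 < t" "t \<le> 1" using c den by (auto simp: t_def field_simps)
  have tc: "(1 - t) * c - t * (b\<^sup>2 / 2) = t / 2"
  proof -
    have "t * (c + b\<^sup>2 / 2 + 1 / 2) = c" using den by (simp add: t_def)
    then show ?thesis by (simp add: algebra_simps)
  qed
  define \<mu> \<nu> s where "\<mu> = d / (d - 1)" "\<nu> = b * d / (d + 2)" "s = b * (2 * d + 1) / (d + 2)"
  have "t / 2 * (X\<^sup>2 + Y\<^sup>2) \<le> X\<^sup>2 - b * X * Y
      + (- (1 - t) * \<nu>) * (X * Y + 2 * Z - (1 + 2 * b) * Y\<^sup>2)
      + ((1 - t) * \<mu>) * (H - X\<^sup>2 - 2 * b * (Z - X * Y))"
    if H: "H \<ge> 2 * s * Z - s\<^sup>2 * Y\<^sup>2 + (X - s * Y)\<^sup>2 / d" for X Y Z H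
  proof -
    define E where "E = X\<^sup>2 - b * X * Y"
    define D where "D = - \<nu> * (X * Y + 2 * Z - (1 + 2 * b) * Y\<^sup>2) + \<mu> * (H - X\<^sup>2 - 2 * b * (Z - X * Y))"
    have "c * Y\<^sup>2 \<le> E + D"
      using form_lower_bound[OF d, of b Z Y X H] H
      by (simp add: c_def E_def D_def \<mu>_\<nu>_s_def)
    then have "(1 - t) * (c * Y\<^sup>2) \<le> (1 - t) * (E + D)"
      using t by (intro mult_left_mono) auto
    moreover have "t * (X\<^sup>2 / 2 - b\<^sup>2 / 2 * Y\<^sup>2) \<le> t * E"
    proof (intro mult_left_mono)
      have "0 \<le> (X - b * Y)\<^sup>2" by simp
      then show "X\<^sup>2 / 2 - b\<^sup>2 / 2 * Y\<^sup>2 \<le> E"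
        by (simp add: E_def power2_eq_square algebra_simps)
    qed (use t in simp)
    ultimately have "((1 - t) * c - t * (b\<^sup>2 / 2)) * Y\<^sup>2 + t / 2 * X\<^sup>2 \<le> E + (1 - t) * D"
      by (simp add: algebra_simps)
    then show ?thesis
      unfolding tc E_def D_def by (simp add: algebra_simps)
  qed
  then show ?thesis
    using t by (intro exI[of _ "t / 2"] conjI exI[of _ "- (1 - t) * \<nu>"] exI[of _ "(1 - t) * \<mu>"] exI[of _ s]) auto
qed

section \<open>The inequality on the torus\<close>

lemma laplacian_powr:
  assumes sm: "smooth \<rho>" and pos: "\<And>x. \<rho> x > 0"
  shows "laplacian (\<lambda>x. \<rho> x powr q) x
    = q * (\<rho> x powr (q - 1) * laplacian \<rho> x + (q - 1) * \<rho> x powr (q - 2) * grad_sq \<rho> x)"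
proof -
  have "partial_deriv i (\<lambda>x. \<rho> x powr q) = (\<lambda>x. q * \<rho> x powr (q - 1) * partial_deriv i \<rho> x)" for i
    using sm pos by (intro ext partial_deriv_powr smooth_differentiable)
  then show ?thesis
    using sm pos unfolding laplacian_def grad_sq_def
    by (simp add: partial_deriv_mult partial_deriv_powr partial_deriv_const smooth_differentiable
        smooth_intros sum.distrib sum_subtractf sum_distrib_left power2_eq_square algebra_simps)
qed

lemma norm_grad_powr_sq:
  assumes sm: "smooth \<rho>" and pos: "\<And>x. \<rho> x > 0"
  shows "(norm (grad (\<lambda>x. \<rho> x powr q) x))\<^sup>2 = q\<^sup>2 * \<rho> x powr (2 * q - 2) * grad_sq \<rho> x"
proof -
  have "\<rho> x powr (2 * q - 2) = (\<rho> x powr (q - 1))\<^sup>2"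
    by (simp add: power2_eq_square powr_add[symmetric])
  then show ?thesis
    using sm pos unfolding power2_norm_eq_inner
    by (simp add: inner_vec_def grad_def grad_sq_def partial_deriv_powr
        smooth_differentiable sum_distrib_left power2_eq_square mult_ac)
qed

theorem theorem2:
  fixes d :: nat and \<alpha> :: real
  assumes "CARD('n::finite) = d"
    and "d > 1"
    and "- (2 * real d * (real d + 2)) / (2 * (real d)\<^sup>2 + 1) < \<alpha>"
    and "\<alpha> < 0"
  shows "\<exists>C\<^sub>0>0. \<forall>\<rho> :: real ^ 'n \<Rightarrow> real.
    torus_fun \<rho> \<longrightarrow> smooth \<rho> \<longrightarrow> (\<forall>x. \<rho> x > 0) \<longrightarrow>
      - torus_integral (\<lambda>x. grad \<rho> x \<bullet>
          grad (\<lambda>y. \<rho> y powr (\<alpha>/2) *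
            (laplacian (\<lambda>z. \<rho> z powr (\<alpha>/2 + 1)) y / (\<alpha>/2 + 1))) x)
      \<ge> C\<^sub>0 * torus_integral (\<lambda>x.
          norm (grad (\<lambda>y. \<rho> y powr (\<alpha>/4 + 1/2)) x) ^ 4 +
          \<bar>laplacian (\<lambda>y. \<rho> y powr (\<alpha>/2 + 1)) x\<bar> ^ 2)"
proof -
  define b where "b = - \<alpha> / 2"
  \<comment> \<open>\<open>K (X\<^sup>2 + Y\<^sup>2)\<close> will dominate the integrand of the right-hand side.\<close>
  define K where "K = ((1 - b) / 2) ^ 4 + 2 * (1 - b)\<^sup>2 * (1 + b\<^sup>2)"
  have exps: "\<alpha> / 2 + 1 = 1 - b" "\<alpha> / 2 = - b" "\<alpha> / 4 + 1 / 2 = (1 - b) / 2"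
    by (auto simp: b_def field_simps)
  have b: "0 < b" "b * (2 * (real d)\<^sup>2 + 1) < real d * (real d + 2)"
    using assms(3,4) by (auto simp: b_def divide_less_eq add_pos_nonneg algebra_simps)
  have "real d * (real d + 2) \<le> 2 * (real d)\<^sup>2 + 1"
    using zero_le_power2[of "real d - 1"] by (simp add: power2_eq_square algebra_simps)
  then have b1: "b < 1"
    using b(2) mult_right_mono[of 1 b "2 * (real d)\<^sup>2 + 1"]
    by (cases "b < 1") (auto simp: not_less)
  obtain C \<kappa> \<mu> s where C: "C > 0" and form: "\<And>X Y Z H.
    H \<ge> 2 * s * Z - s\<^sup>2 * Y\<^sup>2 + (X - s * Y)\<^sup>2 / real d \<Longrightarrow>
    C * (X\<^sup>2 + Y\<^sup>2) \<le> X\<^sup>2 - b * X * Y + \<kappa> * (X * Y + 2 * Z - (1 + 2 * b) * Y\<^sup>2)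
      + \<mu> * (H - X\<^sup>2 - 2 * b * (Z - X * Y))"
  proof -
    have "1 < real d" using assms(2) by simp
    from coercive_form[OF this b] show ?thesis using that by blast
  qed
  have K: "K > 0"
    unfolding K_def using b1 by (intro add_pos_nonneg) auto
  have main: "C / K * torus_integral (\<lambda>x. norm (grad (\<lambda>y. \<rho> y powr ((1 - b) / 2)) x) ^ 4
        + \<bar>laplacian (\<lambda>y. \<rho> y powr (1 - b)) x\<bar> ^ 2)
      \<le> - torus_integral (\<lambda>x. grad \<rho> x \<bullet>
          grad (\<lambda>y. \<rho> y powr (- b) * (laplacian (\<lambda>z. \<rho> z powr (1 - b)) y / (1 - b))) x)"
    if per: "torus_fun \<rho>" and sm: "smooth \<rho>" and pos: "\<And>x. \<rho> x > 0" for \<rho> :: "real ^ 'n \<Rightarrow> real"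
  proof -
    \<comment> \<open>All powers that occur are monomials in \<open>\<rho>\<close> and \<open>w\<close>, so that the pointwise identities below
      become polynomial ones.\<close>
    define w where "w = (\<lambda>x. \<rho> x powr (- b - 1))"
    have powers: "\<rho> x powr (- b) = w x * \<rho> x" "\<rho> x powr (- 2 * b) = (w x)\<^sup>2 * (\<rho> x)\<^sup>2"
      "\<rho> x powr (- 2 * b - 1) = (w x)\<^sup>2 * \<rho> x" "\<rho> x powr (- 2 * b - 1 - 1) = (w x)\<^sup>2" for x
    proof -
      have step: "\<rho> x powr p = \<rho> x powr q * \<rho> x" if "p = q + 1" for p q
        using pos[of x] that by (simp add: powr_add)
      show w2: "\<rho> x powr (- 2 * b - 1 - 1) = (w x)\<^sup>2"
        unfolding w_def power2_eq_square powr_add[symmetric] by (simp add: algebra_simps)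
      show "\<rho> x powr (- b) = w x * \<rho> x"
        unfolding w_def by (rule step) simp
      have "\<rho> x powr (- 2 * b - 1) = \<rho> x powr (- 2 * b - 1 - 1) * \<rho> x"
        by (rule step) simp
      then show w2r: "\<rho> x powr (- 2 * b - 1) = (w x)\<^sup>2 * \<rho> x"
        unfolding w2 .
      have "\<rho> x powr (- 2 * b) = \<rho> x powr (- 2 * b - 1) * \<rho> x"
        by (rule step) simp
      then show "\<rho> x powr (- 2 * b) = (w x)\<^sup>2 * (\<rho> x)\<^sup>2"
        unfolding w2r by (simp add: power2_eq_square)
    qed
    define X where "X = (\<lambda>x. w x * \<rho> x * laplacian \<rho> x)"
    define Y where "Y = (\<lambda>x. w x * grad_sq \<rho> x)"
    define Z where "Z = (\<lambda>x. (w x)\<^sup>2 * \<rho> x * hessian_grad_grad \<rho> x)"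
    define H where "H = (\<lambda>x. (w x)\<^sup>2 * (\<rho> x)\<^sup>2 * hessian_sq \<rho> x)"
    have sm_w: "smooth w" unfolding w_def by (intro smooth_powr sm pos)
    note smooths = sm sm_w smooth_intros smooth_grad_sq smooth_hessian_sq smooth_hessian_grad_grad
    have sm_XYZH: "smooth X" "smooth Y" "smooth Z" "smooth H"
      unfolding X_def Y_def Z_def H_def power2_eq_square by (intro smooths)+
    \<comment> \<open>\<open>E\<close> has the integral of the left-hand side, \<open>D1\<close> and \<open>D2\<close> are the divergences, and \<open>R\<close> is the
      integrand of the right-hand side.\<close>
    define E where "E = (\<lambda>x. X x * X x - b * X x * Y x)"
    define D1 where "D1 = (\<lambda>x. X x * Y x + 2 * Z x - (1 + 2 * b) * (Y x * Y x))"
    define D2 where "D2 = (\<lambda>x. H x - X x * X x - 2 * b * (Z x - X x * Y x))"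
    define R where "R = (\<lambda>x. ((1 - b) / 2) ^ 4 * (Y x * Y x)
      + (1 - b)\<^sup>2 * ((X x - b * Y x) * (X x - b * Y x)))"
    have sm_R: "smooth R" "smooth E" "smooth D1" "smooth D2"
      unfolding R_def E_def D1_def D2_def by (intro smooth_intros sm_XYZH)+
    have lap: "laplacian (\<lambda>y. \<rho> y powr (1 - b)) x = (1 - b) * (X x - b * Y x)" for x
    proof -
      have e: "1 - b - 1 = - b" "1 - b - 2 = - b - 1" by auto
      have "\<rho> x powr (- b - 1) = w x" by (simp add: w_def)
      then show ?thesis
        unfolding laplacian_powr[OF sm pos] e powers by (simp add: X_def Y_def mult_ac)
    qed
    have R: "norm (grad (\<lambda>y. \<rho> y powr ((1 - b) / 2)) x) ^ 4
        + \<bar>laplacian (\<lambda>y. \<rho> y powr (1 - b)) x\<bar> ^ 2 = R x" for x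
    proof -
      have "norm (grad (\<lambda>y. \<rho> y powr ((1 - b) / 2)) x) ^ 4
          = ((norm (grad (\<lambda>y. \<rho> y powr ((1 - b) / 2)) x))\<^sup>2)\<^sup>2"
        by simp
      also have "\<dots> = (((1 - b) / 2)\<^sup>2 * Y x)\<^sup>2"
      proof -
        have q: "2 * ((1 - b) / 2) - 2 = - b - 1" by simp
        show ?thesis
          unfolding norm_grad_powr_sq[OF sm pos] q by (simp add: Y_def w_def mult.assoc)
      qed
      also have "\<dots> = ((1 - b) / 2) ^ 4 * (Y x * Y x)"
        by (simp add: power_mult_distrib power2_eq_square power4_eq_xxxx)
      finally show ?thesis
        unfolding R_def lap by (simp add: power2_eq_square mult_ac)
    qed
    have E: "- torus_integral (\<lambda>x. grad \<rho> x \<bullet>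
          grad (\<lambda>y. \<rho> y powr (- b) * (laplacian (\<lambda>z. \<rho> z powr (1 - b)) y / (1 - b))) x)
        = torus_integral E"
    proof -
      have G: "\<rho> y powr (- b) * (laplacian (\<lambda>z. \<rho> z powr (1 - b)) y / (1 - b))
          = w y * \<rho> y * (X y - b * Y y)" for y
        unfolding lap powers using b1 by simp
      have perG: "torus_fun (\<lambda>y. w y * \<rho> y * (X y - b * Y y))"
        using per torus_fun_laplacian[OF per] torus_fun_grad_sq[OF per]
        unfolding X_def Y_def w_def torus_fun_def by simp
      have "laplacian \<rho> x * (w x * \<rho> x * (X x - b * Y x)) = E x" for x
        unfolding E_def by (simp add: X_def algebra_simps)
      then show ?thesis
        unfolding G
        by (subst torus_integral_grad_inner_grad[OF per sm perG])
          (auto intro!: smooths sm_XYZH)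
    qed
    have D1: "torus_integral D1 = 0"
    proof -
      have "D1 = (\<lambda>x. (- 2 * b - 1) * \<rho> x powr (- 2 * b - 1 - 1) * (grad_sq \<rho> x)\<^sup>2
        + \<rho> x powr (- 2 * b - 1) * (grad_sq \<rho> x * laplacian \<rho> x + 2 * hessian_grad_grad \<rho> x))"
        unfolding powers D1_def X_def Y_def Z_def by (simp add: power2_eq_square algebra_simps)
      then show ?thesis
        using torus_integral_weighted_grad_sq_grad[OF per sm pos, of "- 2 * b - 1"] by simp
    qed
    have D2: "torus_integral D2 = 0"
    proof -
      have "D2 = (\<lambda>x. (- 2 * b) * \<rho> x powr (- 2 * b - 1)
          * (hessian_grad_grad \<rho> x - grad_sq \<rho> x * laplacian \<rho> x)
        + \<rho> x powr (- 2 * b) * (hessian_sq \<rho> x - (laplacian \<rho> x)\<^sup>2))"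
        unfolding powers D2_def H_def X_def Y_def Z_def by (simp add: power2_eq_square algebra_simps)
      then show ?thesis
        using torus_integral_weighted_hessian[OF per sm pos, of "- 2 * b"] by simp
    qed
    have pointwise: "C / K * R x \<le> E x + \<kappa> * D1 x + \<mu> * D2 x" for x
    proof -
      have "H x \<ge> 2 * s * Z x - s\<^sup>2 * (Y x)\<^sup>2 + (X x - s * Y x)\<^sup>2 / real d"
      proof -
        \<comment> \<open>Dividing \<open>s\<close> by \<open>\<rho> x\<close> accounts for the different weights \<open>w * \<rho>\<close> of \<open>X\<close> and \<open>w\<close> of \<open>Y\<close>.\<close>
        have "(w x)\<^sup>2 * (\<rho> x)\<^sup>2 * (2 * (s / \<rho> x) * hessian_grad_grad \<rho> x - (s / \<rho> x)\<^sup>2 * (grad_sq \<rho> x)\<^sup>2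
            + (laplacian \<rho> x - s / \<rho> x * grad_sq \<rho> x)\<^sup>2 / real d) \<le> H x"
          unfolding H_def
          using matrix_sq_lower_bound[of "s / \<rho> x" "\<lambda>i j. partial_deriv i (partial_deriv j \<rho>) x"
              "\<lambda>i. partial_deriv i \<rho> x"] assms(1)
          by (intro mult_left_mono)
            (simp_all add: hessian_grad_grad_def grad_sq_def laplacian_def hessian_sq_def)
        moreover have "(w x)\<^sup>2 * (\<rho> x)\<^sup>2 * (2 * (s / \<rho> x) * hessian_grad_grad \<rho> x - (s / \<rho> x)\<^sup>2 * (grad_sq \<rho> x)\<^sup>2
            + (laplacian \<rho> x - s / \<rho> x * grad_sq \<rho> x)\<^sup>2 / real d)
          = 2 * s * Z x - s\<^sup>2 * (Y x)\<^sup>2 + (X x - s * Y x)\<^sup>2 / real d"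
          using pos[of x] assms(2) unfolding X_def Y_def Z_def
          by (simp add: power2_eq_square field_simps)
        ultimately show ?thesis by simp
      qed
      from form[OF this] have "C * (X x * X x + Y x * Y x) \<le> E x + \<kappa> * D1 x + \<mu> * D2 x"
        by (simp add: E_def D1_def D2_def power2_eq_square)
      moreover have "R x \<le> K * (X x * X x + Y x * Y x)"
      proof -
        have "2 * (1 + b\<^sup>2) * (X x * X x + Y x * Y x) - (X x - b * Y x) * (X x - b * Y x)
            = (X x + b * Y x)\<^sup>2 + 2 * (Y x)\<^sup>2 + 2 * (b * X x)\<^sup>2"
          by (simp add: power2_eq_square algebra_simps)
        also have "\<dots> \<ge> 0" by simp
        finally have "(X x - b * Y x) * (X x - b * Y x) \<le> 2 * (1 + b\<^sup>2) * (X x * X x + Y x * Y x)"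
          by simp
        then have "R x \<le> ((1 - b) / 2) ^ 4 * (X x * X x + Y x * Y x)
            + (1 - b)\<^sup>2 * (2 * (1 + b\<^sup>2) * (X x * X x + Y x * Y x))"
          unfolding R_def by (intro add_mono mult_left_mono) auto
        also have "\<dots> = K * (X x * X x + Y x * Y x)"
          unfolding K_def by (simp add: distrib_right distrib_left mult_ac)
        finally show ?thesis .
      qed
      then have "C / K * R x \<le> C / K * (K * (X x * X x + Y x * Y x))"
        using C K by (intro mult_left_mono) auto
      ultimately show ?thesis using K by simp
    qed
    have "C / K * torus_integral R = integral (cbox 0 1) (\<lambda>x. C / K * R x)"
      by (simp add: torus_integral_def)
    also have "\<dots> \<le> integral (cbox 0 1) (\<lambda>x. E x + \<kappa> * D1 x + \<mu> * D2 x)"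
      by (intro integral_le smooth_integrable smooth_intros sm_R pointwise)
    also have "\<dots> = torus_integral E + \<kappa> * torus_integral D1 + \<mu> * torus_integral D2"
      unfolding torus_integral_def
      by (simp add: integral_add smooth_integrable smooth_intros sm_R)
    finally show ?thesis
      unfolding E R D1 D2 by simp
  qed
  show ?thesis
    unfolding exps using main C K by (intro exI[of _ "C / K"]) auto
qed

end
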